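(* Let $*:\hat S\to\widehat{{}^*S}$ be an enlargement, and let $(\mathcal T,\Sigma,\Delta)$ be a triangulated category with $\mathcal T$ an $\hat S$-small category. Then the triple $({}^*\mathcal T,{}^*\Sigma,{}^*\Delta)$ is again a triangulated category.
   Context: Superstructures: a base set $S$ is an infinite set whose elements are not sets; $S_0=S$, $S_n=S_{n-1}\cup\mathcal P(S_{n-1})$, and $\hat S=\bigcup_{n\ge 0}S_n$. Formulas in $\hat S$ are built from $=$, $\in$, constants in $\hat S$, variables, ordered pairs and function application by $\neg$, $\wedge$ and bounded quantifiers $\forall x\in t$; statements are formulas without free variables. For $\varphi$ a formula in $\hat S$, ${}^*\varphi$ is obtained by replacing each constant $\tau$ by ${}^*\tau$. Enlargement: a map $*:\hat S\to\hat W$ between superstructures with (1) ${}^*S=W$; (2) ${}^*s=s$ for $s\in S$; (3) (transfer) a statement $\varphi$ in $\hat S$ is true iff ${}^*\varphi$ is true; (4) (saturation) with $\mathcal I=\bigcup_{A\in\hat S\setminus S}{}^*A$ (the internal elements), every nonempty family $\{U_i\}_{i\in I}$ of nonempty sets $U_i\in\mathcal I$ with $|I|\le|\hat S|$ and the finite intersection property has nonempty intersection. $\hat S$-small category: a category $\mathcal T=\langle M,s,t,c\rangle$ given by its set of morphisms $M\in\hat S\setminus S$, the maps $s,t:M\to M$ sending a morphism to the identity of its source resp. target, and the composition relation $c$; objects are identified with their identity morphisms. An additive $\hat S$-small category is such a category that is additive, together with the relation $P\subseteq M^3$ recording addition of morphisms; its enlargement ${}^*\mathcal T=\langle{}^*M,{}^*s,{}^*t,{}^*c\rangle$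 with ${}^*P$ is again additive. A triangulated category is a triple $(\mathcal T,\Sigma,\Delta)$ of an additive category $\mathcal T$, an automorphism $\Sigma:\mathcal T\to\mathcal T$, and a class $\Delta$ of triangles $(f,g,h)$, $A\xrightarrow{f}B\xrightarrow{g}C\xrightarrow{h}\Sigma A$, satisfying the usual axioms. If $\mathcal T$ is $\hat S$-small, then $\Sigma$ (a map on morphisms) and $\Delta$ are elements of $\hat S$, so ${}^*\Sigma$ and ${}^*\Delta$ are defined. *)

theory Defs
  imports "HOL-Algebra.Group" "HOL-Library.Equipollence"
begin

section \<open>The ambient set theory with urelements\<close>

text \<open>
  The superstructure over an infinite set is not available as a HOL type, because it is the union
  of infinitely many iterated power sets. The set theory in which superstructures are formed is
  therefore a type class, saying that the type is a model of (second-order) Zermelo set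
  theory with urelements. Every superstructure, and the universe of all sets over a collection of
  urelements, satisfies these axioms. Separation ranges over arbitrary HOL sets \<open>X\<close>, so power sets
  are full power sets.
\<close>

class set_universe =
  fixes elts :: "'a \<Rightarrow> 'a set"
    and is_set :: "'a \<Rightarrow> bool"
  assumes urelement: "\<not> is_set x \<Longrightarrow> elts x = {}"
    and extensionality: "is_set x \<Longrightarrow> is_set y \<Longrightarrow> elts x = elts y \<Longrightarrow> x = y"
    and separation: "X \<subseteq> elts a \<Longrightarrow> \<exists>x. is_set x \<and> elts x = X"
    and pairing: "\<exists>x. is_set x \<and> elts x = {a, b}"
    and union: "\<exists>x. is_set x \<and> elts x = (\<Union>y\<in>elts a. elts y)"
    and powerset: "\<exists>x. is_set x \<and> elts x = {y. is_set y \<and> elts y \<subseteq> elts a}"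

definition set_of :: "'u set \<Rightarrow> 'u::set_universe" where
  "set_of X = (THE x. is_set x \<and> elts x = X)"

definition pair :: "'u \<Rightarrow> 'u \<Rightarrow> 'u::set_universe" where
  "pair a b = set_of {set_of {a}, set_of {a, b}}"

definition triple :: "'u \<Rightarrow> 'u \<Rightarrow> 'u \<Rightarrow> 'u::set_universe" where
  "triple a b c = pair (pair a b) c"

text \<open>
  Function application is made total as is usual in superstructures: \<open>f(a)\<close> is
  the empty set unless there is exactly one \<open>b\<close> with \<open>\<langle>a, b\<rangle> \<in> f\<close>.
\<close>

definition app :: "'u \<Rightarrow> 'u \<Rightarrow> 'u::set_universe" where
  "app f a = (if \<exists>!b. pair a b \<in> elts f then THE b. pair a b \<in> elts f else set_of {})"

definition is_map :: "'u \<Rightarrow> 'u \<Rightarrow> 'u::set_universe \<Rightarrow> bool" where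
  "is_map A B f \<longleftrightarrow> is_set f
     \<and> (\<forall>p\<in>elts f. \<exists>a\<in>elts A. \<exists>b\<in>elts B. p = pair a b)
     \<and> (\<forall>a\<in>elts A. \<exists>!b. pair a b \<in> elts f)"

definition is_rel3 :: "'u \<Rightarrow> 'u::set_universe \<Rightarrow> bool" where
  "is_rel3 A R \<longleftrightarrow> is_set R
     \<and> (\<forall>p\<in>elts R. \<exists>a\<in>elts A. \<exists>b\<in>elts A. \<exists>c\<in>elts A. p = triple a b c)"

definition rel3 :: "'u::set_universe \<Rightarrow> ('u \<times> 'u \<times> 'u) set" where
  "rel3 R = {(a, b, c). triple a b c \<in> elts R}"


section \<open>Superstructures and enlargements\<close>

definition base_set :: "'u::set_universe \<Rightarrow> bool" where
  "base_set S \<longleftrightarrow> is_set S \<and> infinite (elts S) \<and> (\<forall>x\<in>elts S. \<not> is_set x)"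

primrec level :: "'u::set_universe \<Rightarrow> nat \<Rightarrow> 'u set" where
  "level S 0 = elts S"
| "level S (Suc n) = level S n \<union> {x. is_set x \<and> elts x \<subseteq> level S n}"

definition superstructure :: "'u::set_universe \<Rightarrow> 'u set" where
  "superstructure S = (\<Union>n. level S n)"

text \<open>
  Formulas. The type parameter is the type of the constants, so the generated
  map function replaces each constant \<open>\<tau>\<close> by its image.
\<close>

datatype (tm_constants: 'c) tm =
    Const 'c
  | Var nat
  | TPair "'c tm" "'c tm"
  | TApp "'c tm" "'c tm"
  for map: map_tm

datatype (fm_constants: 'c) fm =
    Eq "'c tm" "'c tm"
  | Mem "'c tm" "'c tm"
  | Neg "'c fm"
  | And "'c fm" "'c fm"
  | Forall nat "'c tm" "'c fm"
  for map: map_fm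

primrec tm_vars :: "'c tm \<Rightarrow> nat set" where
  "tm_vars (Const a) = {}"
| "tm_vars (Var n) = {n}"
| "tm_vars (TPair u v) = tm_vars u \<union> tm_vars v"
| "tm_vars (TApp u v) = tm_vars u \<union> tm_vars v"

text \<open>The bounding term of a quantifier lies outside the scope of the bound variable.\<close>

primrec free_vars :: "'c fm \<Rightarrow> nat set" where
  "free_vars (Eq u v) = tm_vars u \<union> tm_vars v"
| "free_vars (Mem u v) = tm_vars u \<union> tm_vars v"
| "free_vars (Neg \<phi>) = free_vars \<phi>"
| "free_vars (And \<phi> \<psi>) = free_vars \<phi> \<union> free_vars \<psi>"
| "free_vars (Forall n u \<phi>) = tm_vars u \<union> (free_vars \<phi> - {n})"

primrec tm_val :: "(nat \<Rightarrow> 'u) \<Rightarrow> 'u tm \<Rightarrow> 'u::set_universe" where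
  "tm_val e (Const a) = a"
| "tm_val e (Var n) = e n"
| "tm_val e (TPair u v) = pair (tm_val e u) (tm_val e v)"
| "tm_val e (TApp u v) = app (tm_val e u) (tm_val e v)"

primrec holds :: "(nat \<Rightarrow> 'u) \<Rightarrow> 'u::set_universe fm \<Rightarrow> bool" where
  "holds e (Eq u v) \<longleftrightarrow> tm_val e u = tm_val e v"
| "holds e (Mem u v) \<longleftrightarrow> tm_val e u \<in> elts (tm_val e v)"
| "holds e (Neg \<phi>) \<longleftrightarrow> \<not> holds e \<phi>"
| "holds e (And \<phi> \<psi>) \<longleftrightarrow> holds e \<phi> \<and> holds e \<psi>"
| "holds e (Forall n u \<phi>) \<longleftrightarrow> (\<forall>x\<in>elts (tm_val e u). holds (e(n := x)) \<phi>)"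

definition statement_in :: "'u::set_universe \<Rightarrow> 'u fm \<Rightarrow> bool" where
  "statement_in S \<phi> \<longleftrightarrow> fm_constants \<phi> \<subseteq> superstructure S \<and> free_vars \<phi> = {}"

text \<open>For a statement the choice of the assignment is irrelevant.\<close>

definition is_true :: "'u::set_universe fm \<Rightarrow> bool" where
  "is_true \<phi> \<longleftrightarrow> (\<forall>e. holds e \<phi>)"

definition internal :: "'u::set_universe \<Rightarrow> ('u \<Rightarrow> 'u) \<Rightarrow> 'u set" where
  "internal S star = (\<Union>A \<in> superstructure S - elts S. elts (star A))"

text \<open>
  In the saturation clause every index set of cardinality at most that of the superstructure
  \<open>superstructure S \<subseteq> UNIV\<close> is, up to bijection, a subset of the universe.
\<close>

definition enlargement :: "'u::set_universe \<Rightarrow> 'u \<Rightarrow> ('u \<Rightarrow> 'u) \<Rightarrow> bool" where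
  "enlargement S W star \<longleftrightarrow>
     base_set S \<and> base_set W
     \<and> star \<in> superstructure S \<rightarrow> superstructure W
     \<and> star S = W
     \<and> (\<forall>x\<in>elts S. star x = x)
     \<and> (\<forall>\<phi>. statement_in S \<phi> \<longrightarrow> is_true \<phi> = is_true (map_fm star \<phi>))
     \<and> (\<forall>(I :: 'u set) U.
          I \<noteq> {} \<and> I \<lesssim> superstructure S
          \<and> (\<forall>i\<in>I. U i \<in> internal S star \<and> is_set (U i) \<and> elts (U i) \<noteq> {})
          \<and> (\<forall>J. J \<subseteq> I \<and> finite J \<and> J \<noteq> {} \<longrightarrow> (\<Inter>i\<in>J. elts (U i)) \<noteq> {})
          \<longrightarrow> (\<Inter>i\<in>I. elts (U i)) \<noteq> {})"


section \<open>Triangulated categories\<close>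

text \<open>
  Categories are given by their morphisms; an object is its identity morphism. The maps \<open>s\<close> and
  \<open>t\<close> send a morphism to the identity of its source and target, and \<open>(f, g, h) \<in> c\<close>
  means that \<open>h\<close> is \<open>f\<close> followed by \<open>g\<close>. Nothing is assumed of \<open>s\<close> and \<open>t\<close> outside \<open>M\<close>.
\<close>

locale category =
  fixes M :: "'a set" and s t :: "'a \<Rightarrow> 'a" and c :: "('a \<times> 'a \<times> 'a) set"
  assumes src_closed: "f \<in> M \<Longrightarrow> s f \<in> M"
    and tgt_closed: "f \<in> M \<Longrightarrow> t f \<in> M"
    and src_src: "f \<in> M \<Longrightarrow> s (s f) = s f"
    and tgt_src: "f \<in> M \<Longrightarrow> t (s f) = s f"
    and src_tgt: "f \<in> M \<Longrightarrow> s (t f) = t f"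
    and tgt_tgt: "f \<in> M \<Longrightarrow> t (t f) = t f"
    and comp_typing: "(f, g, h) \<in> c \<Longrightarrow>
      f \<in> M \<and> g \<in> M \<and> h \<in> M \<and> t f = s g \<and> s h = s f \<and> t h = t g"
    and comp_unique: "f \<in> M \<Longrightarrow> g \<in> M \<Longrightarrow> t f = s g \<Longrightarrow> \<exists>!h. (f, g, h) \<in> c"
    and comp_src: "f \<in> M \<Longrightarrow> (s f, f, f) \<in> c"
    and comp_tgt: "f \<in> M \<Longrightarrow> (f, t f, f) \<in> c"
    and comp_assoc: "(f, g, k) \<in> c \<Longrightarrow> (g, h, l) \<in> c \<Longrightarrow> (k, h, m) \<in> c \<Longrightarrow> (f, l, m) \<in> c"
begin

definition Obj :: "'a set" where
  "Obj = {A \<in> M. s A = A}"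

definition Hom :: "'a \<Rightarrow> 'a \<Rightarrow> 'a set" where
  "Hom A B = {f \<in> M. s f = A \<and> t f = B}"

definition cmp :: "'a \<Rightarrow> 'a \<Rightarrow> 'a" (infixr "\<cdot>" 75) where
  "g \<cdot> f = (THE h. (f, g, h) \<in> c)"

definition iso :: "'a \<Rightarrow> bool" where
  "iso f \<longleftrightarrow> f \<in> M \<and> (\<exists>g \<in> Hom (t f) (s f). g \<cdot> f = s f \<and> f \<cdot> g = t f)"

definition zero_object :: "'a \<Rightarrow> bool" where
  "zero_object Z \<longleftrightarrow> Z \<in> Obj \<and> (\<forall>A\<in>Obj. (\<exists>!f. f \<in> Hom A Z) \<and> (\<exists>!f. f \<in> Hom Z A))"

end

text \<open>\<open>(f, g, h) \<in> P\<close> means \<open>h = f + g\<close>.\<close>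

locale category_with_sum = category +
  fixes P :: "('a \<times> 'a \<times> 'a) set"
  assumes sum_typing: "(f, g, h) \<in> P \<Longrightarrow>
      f \<in> M \<and> g \<in> M \<and> h \<in> M \<and> s f = s g \<and> t f = t g \<and> s h = s f \<and> t h = t f"
    and sum_unique: "f \<in> M \<Longrightarrow> g \<in> M \<Longrightarrow> s f = s g \<Longrightarrow> t f = t g \<Longrightarrow> \<exists>!h. (f, g, h) \<in> P"
begin

definition add :: "'a \<Rightarrow> 'a \<Rightarrow> 'a" (infixl "\<oplus>" 65) where
  "f \<oplus> g = (THE h. (f, g, h) \<in> P)"

definition zero :: "'a \<Rightarrow> 'a \<Rightarrow> 'a" where
  "zero A B = (THE z. z \<in> Hom A B \<and> (\<forall>f\<in>Hom A B. z \<oplus> f = f \<and> f \<oplus> z = f))"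

definition hom_group :: "'a \<Rightarrow> 'a \<Rightarrow> 'a monoid" where
  "hom_group A B = \<lparr>carrier = Hom A B, monoid.mult = (\<oplus>), one = zero A B\<rparr>"

definition neg :: "'a \<Rightarrow> 'a" where
  "neg f = inv\<^bsub>hom_group (s f) (t f)\<^esub> f"

end

locale additive_category = category_with_sum +
  assumes hom_comm_group: "A \<in> Obj \<Longrightarrow> B \<in> Obj \<Longrightarrow> comm_group (hom_group A B)"
    and distrib_left: "f \<in> Hom A B \<Longrightarrow> f' \<in> Hom A B \<Longrightarrow> g \<in> Hom B C \<Longrightarrow>
      g \<cdot> (f \<oplus> f') = (g \<cdot> f) \<oplus> (g \<cdot> f')"
    and distrib_right: "f \<in> Hom A B \<Longrightarrow> g \<in> Hom B C \<Longrightarrow> g' \<in> Hom B C \<Longrightarrow>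
      (g \<oplus> g') \<cdot> f = (g \<cdot> f) \<oplus> (g' \<cdot> f)"
    and zero_object_exists: "\<exists>Z. zero_object Z"
    and biproduct_exists: "A \<in> Obj \<Longrightarrow> B \<in> Obj \<Longrightarrow>
      \<exists>C\<in>Obj. \<exists>i\<in>Hom A C. \<exists>j\<in>Hom B C. \<exists>p\<in>Hom C A. \<exists>q\<in>Hom C B.
        p \<cdot> i = A \<and> q \<cdot> j = B \<and> q \<cdot> i = zero A B \<and> p \<cdot> j = zero B A
        \<and> (i \<cdot> p) \<oplus> (j \<cdot> q) = C"

text \<open>
  \<open>Sig\<close> is an invertible functor, as a map on morphisms; a functor that is bijective on morphisms
  has an inverse functor, and its additivity is automatic.
\<close>

locale additive_category_with_shift = additive_category +
  fixes Sig :: "'a \<Rightarrow> 'a"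
  assumes shift_bij: "bij_betw Sig M M"
    and shift_src: "f \<in> M \<Longrightarrow> Sig (s f) = s (Sig f)"
    and shift_tgt: "f \<in> M \<Longrightarrow> Sig (t f) = t (Sig f)"
    and shift_comp: "(f, g, h) \<in> c \<Longrightarrow> (Sig f, Sig g, Sig h) \<in> c"
begin

definition triangle :: "'a \<times> 'a \<times> 'a \<Rightarrow> bool" where
  "triangle = (\<lambda>(f, g, h). f \<in> M \<and> g \<in> M \<and> h \<in> M
     \<and> t f = s g \<and> t g = s h \<and> t h = Sig (s f))"

definition triangle_mor :: "'a \<times> 'a \<times> 'a \<Rightarrow> 'a \<times> 'a \<times> 'a \<Rightarrow> 'a \<times> 'a \<times> 'a \<Rightarrow> bool" where
  "triangle_mor = (\<lambda>(f, g, h) (f', g', h') (u, v, w).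
     u \<in> Hom (s f) (s f') \<and> v \<in> Hom (s g) (s g') \<and> w \<in> Hom (s h) (s h')
     \<and> v \<cdot> f = f' \<cdot> u \<and> w \<cdot> g = g' \<cdot> v \<and> Sig u \<cdot> h = h' \<cdot> w)"

end

text \<open>
  Verdier's axioms. In the octahedral axiom the three given triangles are those on
  \<open>f\<close>, \<open>g\<close> and \<open>g \<cdot> f\<close>, with cones \<open>s f''\<close>, \<open>s g''\<close> and \<open>s h''\<close>.
\<close>

locale triangulated_category = additive_category_with_shift +
  fixes D :: "('a \<times> 'a \<times> 'a) set"
  assumes distinguished_triangle: "T \<in> D \<Longrightarrow> triangle T"
    and TR1_iso: "(f, g, h) \<in> D \<Longrightarrow> triangle (f', g', h') \<Longrightarrow>
      triangle_mor (f, g, h) (f', g', h') (u, v, w) \<Longrightarrow> iso u \<Longrightarrow> iso v \<Longrightarrow> iso w \<Longrightarrow>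
      (f', g', h') \<in> D"
    and TR1_id: "A \<in> Obj \<Longrightarrow> zero_object Z \<Longrightarrow> (A, zero A Z, zero Z (Sig A)) \<in> D"
    and TR1_cone: "f \<in> M \<Longrightarrow> \<exists>g h. (f, g, h) \<in> D"
    and TR2: "triangle (f, g, h) \<Longrightarrow> (f, g, h) \<in> D \<longleftrightarrow> (g, h, neg (Sig f)) \<in> D"
    and TR3: "(f, g, h) \<in> D \<Longrightarrow> (f', g', h') \<in> D \<Longrightarrow>
      u \<in> Hom (s f) (s f') \<Longrightarrow> v \<in> Hom (s g) (s g') \<Longrightarrow> v \<cdot> f = f' \<cdot> u \<Longrightarrow>
      \<exists>w. triangle_mor (f, g, h) (f', g', h') (u, v, w)"
    and TR4: "t f = s g \<Longrightarrow>
      (f, f', f'') \<in> D \<Longrightarrow> (g, g', g'') \<in> D \<Longrightarrow> (g \<cdot> f, h', h'') \<in> D \<Longrightarrow>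
      \<exists>u\<in>Hom (s f'') (s h''). \<exists>v\<in>Hom (s h'') (s g'').
        (u, v, Sig f' \<cdot> g'') \<in> D
        \<and> u \<cdot> f' = h' \<cdot> g \<and> h'' \<cdot> u = f'' \<and> v \<cdot> h' = g' \<and> g'' \<cdot> v = Sig f \<cdot> h''"


section \<open>Triangulated categories inside the universe\<close>

text \<open>
  Here all data are elements of the universe: \<open>M\<close> is a set, \<open>s\<close>, \<open>t\<close> and \<open>Sig\<close> are set-theoretic maps
  from \<open>M\<close> to \<open>M\<close>, and \<open>c\<close>, \<open>P\<close> and \<open>D\<close> are sets of triples from \<open>M\<close>. If \<open>M\<close> lies in a
  superstructure, then so do all of these.
\<close>

definition set_triangulated ::
    "'u::set_universe \<Rightarrow> 'u \<Rightarrow> 'u \<Rightarrow> 'u \<Rightarrow> 'u \<Rightarrow> 'u \<Rightarrow> 'u \<Rightarrow> bool" where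
  "set_triangulated M s t c P Sig D \<longleftrightarrow>
     is_set M \<and> is_map M M s \<and> is_map M M t \<and> is_rel3 M c \<and> is_rel3 M P
     \<and> is_map M M Sig \<and> is_rel3 M D
     \<and> triangulated_category (elts M) (app s) (app t) (rel3 c) (rel3 P) (app Sig) (rel3 D)"

end

theory Submission
  imports Defs
begin

text \<open>
  The axioms of a triangulated category are a finite list of statements about the set \<open>M\<close> of
  morphisms and the sets \<open>s\<close>, \<open>t\<close>, \<open>c\<close>, \<open>P\<close>, \<open>Sig\<close>, \<open>D\<close>, and every quantifier in them can be bounded
  by \<open>M\<close>. So the transfer principle applies to them. Two things have to be made precise.

  First, a HOL predicate must be recognised as the meaning of a formula. The relation
  \<open>transfers S star n p q\<close> says that some formula with constants in the superstructure has the meaning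
  \<open>p\<close>, while its image under \<open>star\<close> has the meaning \<open>q\<close>. It is closed under the connectives
  and bounded quantifiers (\<open>transfer_rules\<close>), so no formula is ever written down: for a bounded
  predicate the derivation is found by applying these rules backwards. Lemma
  \<open>enlargement_transfer\<close> then gives \<open>p \<longleftrightarrow> q\<close> for closed statements.

  Second, the axioms must be brought into bounded form; in particular their definite descriptions
  must go. Since the triple \<open>\<langle>f, g, h\<rangle>\<close> is the pair \<open>\<langle>\<langle>f, g\<rangle>, h\<rangle>\<close>, the relations \<open>c\<close> and \<open>P\<close> are
  partial functions on pairs, and the composite and the sum of morphisms are the terms
  \<open>app c (pair f g)\<close> and \<open>app P (pair f g)\<close> of the formal language. Zero morphisms are the
  solutions of \<open>x + x = x\<close>, and the negative of \<open>f\<close> is the solution of \<open>(f + x) + f = f\<close>. In this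
  way each layer of the axioms (category, addition, additivity, shift, triangles) is equivalent
  to a bounded sentence, provided that the previous layers hold (\<open>category_iff\<close>,
  \<open>category_with_sum_iff\<close>, \<open>additive_iff\<close>, \<open>additive_with_shift_iff\<close>, \<open>triangulated_iff\<close>). The
  sentences transfer, and the layers of the starred structure are recovered one after the other.
\<close>

section \<open>Sets, pairs and application\<close>

lemma set_of:
  assumes "\<exists>x::'u::set_universe. is_set x \<and> elts x = X"
  shows is_set_set_of: "is_set (set_of X :: 'u)" and elts_set_of: "elts (set_of X :: 'u) = X"
proof -
  have "\<exists>!x::'u. is_set x \<and> elts x = X"
    using assms extensionality by blast
  then have "is_set (set_of X :: 'u) \<and> elts (set_of X :: 'u) = X"
    unfolding set_of_def by (rule theI')
  then show "is_set (set_of X :: 'u)" and "elts (set_of X :: 'u) = X"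
    by auto
qed

lemma elts_set_of_pair [simp]: "elts (set_of {a, b}) = {a, b}"
  by (rule elts_set_of) (rule pairing)

lemma is_set_set_of_pair [simp]: "is_set (set_of {a, b})"
  by (rule is_set_set_of) (rule pairing)

lemma elts_set_of_single [simp]: "elts (set_of {a}) = {a}"
  using elts_set_of_pair[of a a] by simp

lemma is_set_set_of_single [simp]: "is_set (set_of {a})"
  using is_set_set_of_pair[of a a] by simp

lemma pair_eq_iff [simp]: "pair a b = pair a' b' \<longleftrightarrow> a = a' \<and> b = b'"
proof
  assume "pair a b = pair a' b'"
  then have "elts (pair a b) = elts (pair a' b')"
    by simp
  then have "{set_of {a}, set_of {a, b}} = {set_of {a'}, set_of {a', b'}}"
    by (simp add: pair_def)
  then have "elts ` {set_of {a}, set_of {a, b}} = elts ` {set_of {a'}, set_of {a', b'}}"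
    by (rule arg_cong)
  then have "{{a}, {a, b}} = {{a'}, {a', b'}}"
    by simp
  then show "a = a' \<and> b = b'"
    by (auto simp: doubleton_eq_iff)
qed simp

lemma triple_eq_iff [simp]: "triple a b c = triple a' b' c' \<longleftrightarrow> a = a' \<and> b = b' \<and> c = c'"
  by (auto simp: triple_def)

lemma rel3_iff [simp]: "(a, b, c) \<in> rel3 R \<longleftrightarrow> triple a b c \<in> elts R"
  by (simp add: rel3_def)

lemma is_rel3_D: "is_rel3 A R \<Longrightarrow> triple a b c \<in> elts R \<Longrightarrow> a \<in> elts A \<and> b \<in> elts A \<and> c \<in> elts A"
  by (force simp: is_rel3_def)

lemma app_eq: "\<exists>!b. pair a b \<in> elts f \<Longrightarrow> app f a = (THE b. pair a b \<in> elts f)"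
  by (simp add: app_def)

lemma app_in:
  assumes "is_map A B f" "a \<in> elts A"
  shows "app f a \<in> elts B"
proof -
  have ex: "\<exists>!b. pair a b \<in> elts f"
    using assms by (simp add: is_map_def)
  then have "pair a (app f a) \<in> elts f"
    unfolding app_eq[OF ex] by (rule theI')
  then show ?thesis
    using assms(1) by (force simp: is_map_def)
qed

section \<open>Superstructures\<close>

lemma level_mono: "m \<le> n \<Longrightarrow> level S m \<subseteq> level S n"
  by (rule lift_Suc_mono_le) auto

lemma superstructure_set:
  assumes "A \<in> superstructure S" "A \<notin> elts S"
  shows "is_set A" and "\<exists>n. elts A \<subseteq> level S n"
proof -
  have "is_set A \<and> (\<exists>n. elts A \<subseteq> level S n)" if "A \<in> level S n" for n
    using that assms(2) by (induction n) auto
  then show "is_set A" and "\<exists>n. elts A \<subseteq> level S n"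
    using assms(1) by (auto simp: superstructure_def)
qed

lemma in_superstructure: "is_set A \<Longrightarrow> elts A \<subseteq> level S n \<Longrightarrow> A \<in> superstructure S"
  unfolding superstructure_def by (rule UN_I[of "Suc n"]) auto

lemma pair_in_level: "a \<in> level S n \<Longrightarrow> b \<in> level S n \<Longrightarrow> pair a b \<in> level S (n + 2)"
  by (simp add: pair_def)

lemma triple_in_level:
  assumes "a \<in> level S n" "b \<in> level S n" "c \<in> level S n"
  shows "triple a b c \<in> level S (n + 4)"
proof -
  have "c \<in> level S (n + 2)"
    using assms(3) level_mono[of n "n + 2" S] by auto
  then have "triple a b c \<in> level S (n + 2 + 2)"
    unfolding triple_def using assms by (intro pair_in_level) auto
  then show ?thesis
    by (simp add: numeral_eq_Suc)
qed

text \<open>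
  Maps from \<open>A\<close> to \<open>A\<close>, and ternary relations on \<open>A\<close>, lie in the superstructure, because all
  elements of a set \<open>A\<close> of the superstructure lie in one common level.
\<close>

lemma map_in_superstructure:
  assumes "A \<in> superstructure S" "A \<notin> elts S" "is_map A A f"
  shows "f \<in> superstructure S"
proof -
  obtain n where n: "elts A \<subseteq> level S n"
    using superstructure_set assms by blast
  have "elts f \<subseteq> level S (n + 2)"
  proof
    fix p assume "p \<in> elts f"
    then obtain a b where "a \<in> elts A" "b \<in> elts A" "p = pair a b"
      using assms(3) unfolding is_map_def by blast
    then show "p \<in> level S (n + 2)"
      using n pair_in_level by blast
  qed
  then show ?thesis
    using assms(3) in_superstructure unfolding is_map_def by blast
qed

lemma rel3_in_superstructure:
  assumes "A \<in> superstructure S" "A \<notin> elts S" "is_rel3 A R"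
  shows "R \<in> superstructure S"
proof -
  obtain n where n: "elts A \<subseteq> level S n"
    using superstructure_set assms by blast
  have "elts R \<subseteq> level S (n + 4)"
  proof
    fix p assume "p \<in> elts R"
    then obtain a b c where "a \<in> elts A" "b \<in> elts A" "c \<in> elts A" "p = triple a b c"
      using assms(3) unfolding is_rel3_def by blast
    then show "p \<in> level S (n + 4)"
      using n triple_in_level by blast
  qed
  then show ?thesis
    using assms(3) in_superstructure unfolding is_rel3_def by blast
qed

section \<open>Transfer of bounded properties\<close>

text \<open>
  Some term \<open>\<tau>\<close> with constants in the superstructure and variables below \<open>n\<close> has the value \<open>u e\<close>
  under every assignment \<open>e\<close>, and the starred term has the value \<open>v e\<close>.
\<close>

definition term_transfers ::
    "'u::set_universe \<Rightarrow> ('u \<Rightarrow> 'u) \<Rightarrow> nat \<Rightarrow> ((nat \<Rightarrow> 'u) \<Rightarrow> 'u) \<Rightarrow> ((nat \<Rightarrow> 'u) \<Rightarrow> 'u) \<Rightarrow> bool" where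
  "term_transfers S star n u v \<longleftrightarrow> (\<exists>\<tau>. tm_constants \<tau> \<subseteq> superstructure S \<and> tm_vars \<tau> \<subseteq> {..<n}
     \<and> (\<forall>e. tm_val e \<tau> = u e \<and> tm_val e (map_tm star \<tau>) = v e))"

text \<open>
  The same for formulas. A closed statement is the case \<open>n = 0\<close>; under \<open>n\<close> nested quantifiers the
  bound variables are numbered from the outside by \<open>0, \<dots>, n - 1\<close>.
\<close>

definition transfers ::
    "'u::set_universe \<Rightarrow> ('u \<Rightarrow> 'u) \<Rightarrow> nat \<Rightarrow> ((nat \<Rightarrow> 'u) \<Rightarrow> bool) \<Rightarrow> ((nat \<Rightarrow> 'u) \<Rightarrow> bool) \<Rightarrow> bool" where
  "transfers S star n p q \<longleftrightarrow> (\<exists>\<phi>. fm_constants \<phi> \<subseteq> superstructure S \<and> free_vars \<phi> \<subseteq> {..<n}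
     \<and> (\<forall>e. holds e \<phi> = p e \<and> holds e (map_fm star \<phi>) = q e))"

lemma transfer_const:
  "a \<in> superstructure S \<Longrightarrow> term_transfers S star n (\<lambda>e. a) (\<lambda>e. star a)"
  unfolding term_transfers_def by (rule exI[of _ "Const a"]) simp

lemma transfer_var: "i < n \<Longrightarrow> term_transfers S star n (\<lambda>e. e i) (\<lambda>e. e i)"
  unfolding term_transfers_def by (rule exI[of _ "Var i"]) simp

lemma transfer_pair:
  assumes "term_transfers S star n u u'" "term_transfers S star n v v'"
  shows "term_transfers S star n (\<lambda>e. pair (u e) (v e)) (\<lambda>e. pair (u' e) (v' e))"
proof -
  obtain \<sigma> \<tau> where "tm_constants \<sigma> \<subseteq> superstructure S \<and> tm_vars \<sigma> \<subseteq> {..<n}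
     \<and> (\<forall>e. tm_val e \<sigma> = u e \<and> tm_val e (map_tm star \<sigma>) = u' e)"
    "tm_constants \<tau> \<subseteq> superstructure S \<and> tm_vars \<tau> \<subseteq> {..<n}
     \<and> (\<forall>e. tm_val e \<tau> = v e \<and> tm_val e (map_tm star \<tau>) = v' e)"
    using assms unfolding term_transfers_def by blast
  then show ?thesis
    unfolding term_transfers_def by (intro exI[of _ "TPair \<sigma> \<tau>"]) auto
qed

lemma transfer_app:
  assumes "term_transfers S star n u u'" "term_transfers S star n v v'"
  shows "term_transfers S star n (\<lambda>e. app (u e) (v e)) (\<lambda>e. app (u' e) (v' e))"
proof -
  obtain \<sigma> \<tau> where "tm_constants \<sigma> \<subseteq> superstructure S \<and> tm_vars \<sigma> \<subseteq> {..<n}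
     \<and> (\<forall>e. tm_val e \<sigma> = u e \<and> tm_val e (map_tm star \<sigma>) = u' e)"
    "tm_constants \<tau> \<subseteq> superstructure S \<and> tm_vars \<tau> \<subseteq> {..<n}
     \<and> (\<forall>e. tm_val e \<tau> = v e \<and> tm_val e (map_tm star \<tau>) = v' e)"
    using assms unfolding term_transfers_def by blast
  then show ?thesis
    unfolding term_transfers_def by (intro exI[of _ "TApp \<sigma> \<tau>"]) auto
qed

lemma transfer_triple:
  assumes "term_transfers S star n u u'" "term_transfers S star n v v'" "term_transfers S star n w w'"
  shows "term_transfers S star n (\<lambda>e. triple (u e) (v e) (w e)) (\<lambda>e. triple (u' e) (v' e) (w' e))"
  unfolding triple_def by (intro transfer_pair assms)

lemma transfer_eq:
  assumes "term_transfers S star n u u'" "term_transfers S star n v v'"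
  shows "transfers S star n (\<lambda>e. u e = v e) (\<lambda>e. u' e = v' e)"
proof -
  obtain \<sigma> \<tau> where "tm_constants \<sigma> \<subseteq> superstructure S \<and> tm_vars \<sigma> \<subseteq> {..<n}
     \<and> (\<forall>e. tm_val e \<sigma> = u e \<and> tm_val e (map_tm star \<sigma>) = u' e)"
    "tm_constants \<tau> \<subseteq> superstructure S \<and> tm_vars \<tau> \<subseteq> {..<n}
     \<and> (\<forall>e. tm_val e \<tau> = v e \<and> tm_val e (map_tm star \<tau>) = v' e)"
    using assms unfolding term_transfers_def by blast
  then show ?thesis
    unfolding transfers_def by (intro exI[of _ "Eq \<sigma> \<tau>"]) auto
qed

lemma transfer_mem:
  assumes "term_transfers S star n u u'" "term_transfers S star n v v'"
  shows "transfers S star n (\<lambda>e. u e \<in> elts (v e)) (\<lambda>e. u' e \<in> elts (v' e))"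
proof -
  obtain \<sigma> \<tau> where "tm_constants \<sigma> \<subseteq> superstructure S \<and> tm_vars \<sigma> \<subseteq> {..<n}
     \<and> (\<forall>e. tm_val e \<sigma> = u e \<and> tm_val e (map_tm star \<sigma>) = u' e)"
    "tm_constants \<tau> \<subseteq> superstructure S \<and> tm_vars \<tau> \<subseteq> {..<n}
     \<and> (\<forall>e. tm_val e \<tau> = v e \<and> tm_val e (map_tm star \<tau>) = v' e)"
    using assms unfolding term_transfers_def by blast
  then show ?thesis
    unfolding transfers_def by (intro exI[of _ "Mem \<sigma> \<tau>"]) auto
qed

lemma transfer_not:
  assumes "transfers S star n p q"
  shows "transfers S star n (\<lambda>e. \<not> p e) (\<lambda>e. \<not> q e)"
proof -
  obtain \<phi> where "fm_constants \<phi> \<subseteq> superstructure S \<and> free_vars \<phi> \<subseteq> {..<n}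
     \<and> (\<forall>e. holds e \<phi> = p e \<and> holds e (map_fm star \<phi>) = q e)"
    using assms unfolding transfers_def by blast
  then show ?thesis
    unfolding transfers_def by (intro exI[of _ "Neg \<phi>"]) auto
qed

lemma transfer_conj:
  assumes "transfers S star n p q" "transfers S star n p' q'"
  shows "transfers S star n (\<lambda>e. p e \<and> p' e) (\<lambda>e. q e \<and> q' e)"
proof -
  obtain \<phi> \<psi> where "fm_constants \<phi> \<subseteq> superstructure S \<and> free_vars \<phi> \<subseteq> {..<n}
     \<and> (\<forall>e. holds e \<phi> = p e \<and> holds e (map_fm star \<phi>) = q e)"
    "fm_constants \<psi> \<subseteq> superstructure S \<and> free_vars \<psi> \<subseteq> {..<n}
     \<and> (\<forall>e. holds e \<psi> = p' e \<and> holds e (map_fm star \<psi>) = q' e)"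
    using assms unfolding transfers_def by blast
  then show ?thesis
    unfolding transfers_def by (intro exI[of _ "And \<phi> \<psi>"]) auto
qed

lemma transfer_imp:
  assumes "transfers S star n p q" "transfers S star n p' q'"
  shows "transfers S star n (\<lambda>e. p e \<longrightarrow> p' e) (\<lambda>e. q e \<longrightarrow> q' e)"
  using transfer_not[OF transfer_conj[OF assms(1) transfer_not[OF assms(2)]]] by simp

lemma transfer_iff:
  assumes "transfers S star n p q" "transfers S star n p' q'"
  shows "transfers S star n (\<lambda>e. p e \<longleftrightarrow> p' e) (\<lambda>e. q e \<longleftrightarrow> q' e)"
  unfolding iff_conv_conj_imp by (intro transfer_conj transfer_imp assms)

text \<open>
  The new variable is \<open>n\<close>. The predicates in the conclusion still refer to the assignment for the
  outer variables; the last two premises say that they do not refer to its value at \<open>n\<close>. When the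
  rule is applied backwards to a concrete statement, simplification proves these two premises.
\<close>

lemma transfer_ball:
  assumes "term_transfers S star n u v"
    and "transfers S star (Suc n) (\<lambda>e. p e (e n)) (\<lambda>e. q e (e n))"
    and "\<And>e x. p (e(n := x)) = p e" "\<And>e x. q (e(n := x)) = q e"
  shows "transfers S star n (\<lambda>e. \<forall>x\<in>elts (u e). p e x) (\<lambda>e. \<forall>x\<in>elts (v e). q e x)"
proof -
  obtain \<tau> where \<tau>: "tm_constants \<tau> \<subseteq> superstructure S \<and> tm_vars \<tau> \<subseteq> {..<n}
     \<and> (\<forall>e. tm_val e \<tau> = u e \<and> tm_val e (map_tm star \<tau>) = v e)"
    using assms(1) unfolding term_transfers_def by blast
  obtain \<phi> where \<phi>: "fm_constants \<phi> \<subseteq> superstructure S \<and> free_vars \<phi> \<subseteq> {..<Suc n}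
     \<and> (\<forall>e. holds e \<phi> = p e (e n) \<and> holds e (map_fm star \<phi>) = q e (e n))"
    using assms(2) unfolding transfers_def by blast
  have "free_vars (Forall n \<tau> \<phi>) \<subseteq> {..<n}"
    using \<tau> \<phi> by (auto simp: less_Suc_eq subset_iff)
  then show ?thesis
    using \<tau> \<phi> assms(3,4) unfolding transfers_def by (intro exI[of _ "Forall n \<tau> \<phi>"]) auto
qed

lemma transfer_bex:
  assumes "term_transfers S star n u v"
    and "transfers S star (Suc n) (\<lambda>e. p e (e n)) (\<lambda>e. q e (e n))"
    and "\<And>e x. p (e(n := x)) = p e" "\<And>e x. q (e(n := x)) = q e"
  shows "transfers S star n (\<lambda>e. \<exists>x\<in>elts (u e). p e x) (\<lambda>e. \<exists>x\<in>elts (v e). q e x)"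
proof -
  have "transfers S star n (\<lambda>e. \<forall>x\<in>elts (u e). \<not> p e x) (\<lambda>e. \<forall>x\<in>elts (v e). \<not> q e x)"
    using assms(2) by (intro transfer_ball assms(1) transfer_not) (simp_all add: assms(3,4))
  from transfer_not[OF this] show ?thesis
    by simp
qed

lemmas transfer_rules = transfer_ball transfer_bex transfer_conj transfer_imp transfer_iff transfer_not
  transfer_eq transfer_mem transfer_triple transfer_pair transfer_app transfer_var transfer_const

lemma enlargement_transfer:
  assumes "enlargement S W star" "transfers S star 0 (\<lambda>_. p) (\<lambda>_. q)"
  shows "p \<longleftrightarrow> q"
proof -
  obtain \<phi> where \<phi>: "fm_constants \<phi> \<subseteq> superstructure S" "free_vars \<phi> = {}"
    "\<forall>e. holds e \<phi> = p" "\<forall>e. holds e (map_fm star \<phi>) = q"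
    using assms(2) unfolding transfers_def by auto
  then have "is_true \<phi> = is_true (map_fm star \<phi>)"
    using assms(1) by (simp add: enlargement_def statement_in_def)
  then show ?thesis
    using \<phi> by (simp add: is_true_def)
qed

text \<open>
  The formal language has no predicate for being a set, but the sets in a superstructure are its
  elements outside the base set.
\<close>

lemma is_set_star:
  assumes enl: "enlargement S W star" and "A \<in> superstructure S" "is_set A"
  shows "is_set (star A)"
proof -
  have S: "is_set S" "\<forall>x\<in>elts S. \<not> is_set x" "star S = W"
    using enl by (auto simp: enlargement_def base_set_def)
  then have "S \<in> superstructure S"
    by (intro in_superstructure[of _ _ 0]) auto
  then have "A \<notin> elts S \<longleftrightarrow> star A \<notin> elts (star S)"
    using assms by (intro enlargement_transfer[OF enl] transfer_rules)
  then have "star A \<notin> elts W"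
    using S assms by auto
  moreover have "star A \<in> superstructure W"
    using assms by (auto simp: enlargement_def)
  ultimately show ?thesis
    by (rule superstructure_set(1)[rotated])
qed

section \<open>Maps and relations\<close>

text \<open>That \<open>f\<close> is a map from \<open>A\<close> to \<open>A\<close>, except that \<open>f\<close> is a set, in bounded form.\<close>

definition map_sentence :: "'u::set_universe \<Rightarrow> 'u \<Rightarrow> bool" where
  "map_sentence A f \<longleftrightarrow> (\<forall>p\<in>elts f. \<exists>a\<in>elts A. \<exists>b\<in>elts A. p = pair a b)
     \<and> (\<forall>a\<in>elts A. \<exists>b\<in>elts A. pair a b \<in> elts f \<and> (\<forall>b'\<in>elts A. pair a b' \<in> elts f \<longrightarrow> b' = b))"

lemma is_map_iff: "is_map A A f \<longleftrightarrow> is_set f \<and> map_sentence A f"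
proof -
  have "(\<exists>!b. pair a b \<in> elts f)
      \<longleftrightarrow> (\<exists>b\<in>elts A. pair a b \<in> elts f \<and> (\<forall>b'\<in>elts A. pair a b' \<in> elts f \<longrightarrow> b' = b))"
    if "\<forall>p\<in>elts f. \<exists>a\<in>elts A. \<exists>b\<in>elts A. p = pair a b" for a
  proof -
    have "b \<in> elts A" if "pair a b \<in> elts f" for b
      using \<open>\<forall>p\<in>elts f. _\<close> that by force
    then show ?thesis
      by blast
  qed
  then show ?thesis
    unfolding is_map_def map_sentence_def by (simp cong: conj_cong)
qed

lemma is_map_star:
  assumes enl: "enlargement S W star" and A: "A \<in> superstructure S" "A \<notin> elts S"
    and f: "is_map A A f"
  shows "is_map (star A) (star A) (star f)"
proof -
  note f' = map_in_superstructure[OF A f]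
  have "map_sentence A f \<longleftrightarrow> map_sentence (star A) (star f)"
    unfolding map_sentence_def
    by (rule enlargement_transfer[OF enl]) (intro transfer_rules A(1) f'; simp)
  then show ?thesis
    using f is_set_star[OF enl f'] by (simp add: is_map_iff)
qed

lemma is_rel3_star:
  assumes enl: "enlargement S W star" and A: "A \<in> superstructure S" "A \<notin> elts S"
    and R: "is_rel3 A R"
  shows "is_rel3 (star A) (star R)"
proof -
  note R' = rel3_in_superstructure[OF A R]
  have "(\<forall>p\<in>elts R. \<exists>a\<in>elts A. \<exists>b\<in>elts A. \<exists>c\<in>elts A. p = triple a b c)
     \<longleftrightarrow> (\<forall>p\<in>elts (star R). \<exists>a\<in>elts (star A). \<exists>b\<in>elts (star A). \<exists>c\<in>elts (star A). p = triple a b c)"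
    by (rule enlargement_transfer[OF enl]) (intro transfer_rules A(1) R'; simp)
  then show ?thesis
    using R is_set_star[OF enl R'] by (simp add: is_rel3_def)
qed

section \<open>Categories\<close>

text \<open>
  The category axioms with all quantifiers bounded by \<open>M\<close>; unique existence is spelled out.
\<close>

definition category_sentence :: "'u::set_universe \<Rightarrow> 'u \<Rightarrow> 'u \<Rightarrow> 'u \<Rightarrow> bool" where
  "category_sentence M s t c \<longleftrightarrow>
     (\<forall>f\<in>elts M. app s f \<in> elts M \<and> app t f \<in> elts M
        \<and> app s (app s f) = app s f \<and> app t (app s f) = app s f
        \<and> app s (app t f) = app t f \<and> app t (app t f) = app t f
        \<and> triple (app s f) f f \<in> elts c \<and> triple f (app t f) f \<in> elts c)
     \<and> (\<forall>f\<in>elts M. \<forall>g\<in>elts M. \<forall>h\<in>elts M. triple f g h \<in> elts c \<longrightarrow>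
          app t f = app s g \<and> app s h = app s f \<and> app t h = app t g)
     \<and> (\<forall>f\<in>elts M. \<forall>g\<in>elts M. app t f = app s g \<longrightarrow>
          (\<exists>h\<in>elts M. triple f g h \<in> elts c \<and> (\<forall>h'\<in>elts M. triple f g h' \<in> elts c \<longrightarrow> h' = h)))
     \<and> (\<forall>f\<in>elts M. \<forall>g\<in>elts M. \<forall>k\<in>elts M. \<forall>h\<in>elts M. \<forall>l\<in>elts M. \<forall>m\<in>elts M.
          triple f g k \<in> elts c \<and> triple g h l \<in> elts c \<and> triple k h m \<in> elts c \<longrightarrow>
          triple f l m \<in> elts c)"

lemma bounded_ex1:
  assumes "\<And>h. triple f g h \<in> elts R \<Longrightarrow> h \<in> elts A"
  shows "(\<exists>!h. triple f g h \<in> elts R)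
    \<longleftrightarrow> (\<exists>h\<in>elts A. triple f g h \<in> elts R \<and> (\<forall>h'\<in>elts A. triple f g h' \<in> elts R \<longrightarrow> h' = h))"
  using assms by blast

lemma category_iff:
  assumes "is_rel3 M c"
  shows "category (elts M) (app s) (app t) (rel3 c) \<longleftrightarrow> category_sentence M s t c"
proof -
  note D = is_rel3_D[OF assms]
  have ex1: "(\<exists>!h. triple f g h \<in> elts c)
    \<longleftrightarrow> (\<exists>h\<in>elts M. triple f g h \<in> elts c \<and> (\<forall>h'\<in>elts M. triple f g h' \<in> elts c \<longrightarrow> h' = h))" for f g
    by (rule bounded_ex1) (use D in blast)
  show ?thesis
  proof
    assume "category (elts M) (app s) (app t) (rel3 c)"
    then interpret category "elts M" "app s" "app t" "rel3 c" .
    show "category_sentence M s t c"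
      unfolding category_sentence_def ex1[symmetric]
      apply (intro conjI)
      subgoal using src_closed tgt_closed src_src tgt_src src_tgt tgt_tgt comp_src comp_tgt by simp
      subgoal using comp_typing by (auto simp: rel3_def)
      subgoal using comp_unique by (simp add: rel3_def)
      subgoal using comp_assoc unfolding rel3_iff by blast
      done
  next
    assume C: "category_sentence M s t c"
    note C = this[unfolded category_sentence_def ex1[symmetric]]
    show "category (elts M) (app s) (app t) (rel3 c)"
    proof (unfold_locales, unfold rel3_iff)
      fix f g h
      assume fgh: "triple f g h \<in> elts c"
      then show "f \<in> elts M \<and> g \<in> elts M \<and> h \<in> elts M
          \<and> app t f = app s g \<and> app s h = app s f \<and> app t h = app t g"
        using C[THEN conjunct2, THEN conjunct1] D[OF fgh] by blast
    next
      fix f g k h l m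
      assume "triple f g k \<in> elts c" "triple g h l \<in> elts c" "triple k h m \<in> elts c"
      then show "triple f l m \<in> elts c"
        using C D[of f g k] D[of g h l] D[of k h m] by blast
    qed (use C[THEN conjunct1] C[THEN conjunct2, THEN conjunct2, THEN conjunct1] in blast)+
  qed
qed

lemma (in category) cmp_in:
  assumes "f \<in> M" "g \<in> M" "t f = s g"
  shows "g \<cdot> f \<in> M" "s (g \<cdot> f) = s f" "t (g \<cdot> f) = t g"
proof -
  have "(f, g, g \<cdot> f) \<in> c"
    unfolding cmp_def using comp_unique[OF assms] by (rule theI')
  then show "g \<cdot> f \<in> M" "s (g \<cdot> f) = s f" "t (g \<cdot> f) = t g"
    using comp_typing by auto
qed

lemma (in category) Ball_Hom: "(\<forall>f\<in>Hom A B. Q f) \<longleftrightarrow> (\<forall>f\<in>M. s f = A \<and> t f = B \<longrightarrow> Q f)"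
  and Bex_Hom: "(\<exists>f\<in>Hom A B. Q f) \<longleftrightarrow> (\<exists>f\<in>M. (s f = A \<and> t f = B) \<and> Q f)"
  and Bex_Obj: "(\<exists>C\<in>Obj. R C) \<longleftrightarrow> (\<exists>C\<in>M. s C = C \<and> R C)"
  by (auto simp: Hom_def Obj_def)

lemma (in category) src_tgt_Obj: "f \<in> M \<Longrightarrow> s f \<in> Obj" "f \<in> M \<Longrightarrow> t f \<in> Obj"
  using src_closed tgt_closed src_src src_tgt by (auto simp: Obj_def)

text \<open>
  A category whose data are elements of the universe. The locales \<open>set_category_with_sum\<close>,
  \<open>set_additive_category\<close> and \<open>set_additive_category_with_shift\<close> below extend it in the same way.
\<close>

locale set_category =
  fixes M s t c :: "'u::set_universe"
  assumes comp_rel: "is_rel3 M c"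
    and is_category: "category (elts M) (app s) (app t) (rel3 c)"

sublocale set_category \<subseteq> category "elts M" "app s" "app t" "rel3 c"
  by (rule is_category)

text \<open>
  Bounded forms of \<open>Z\<close> being a zero object and of \<open>f\<close> being an isomorphism, for \<open>Z\<close> and \<open>f\<close> in \<open>M\<close>.
\<close>

definition zero_object_formula :: "'u::set_universe \<Rightarrow> 'u \<Rightarrow> 'u \<Rightarrow> 'u \<Rightarrow> bool" where
  "zero_object_formula M s t Z \<longleftrightarrow> app s Z = Z
     \<and> (\<forall>A\<in>elts M. app s A = A \<longrightarrow>
          (\<exists>f\<in>elts M. (app s f = A \<and> app t f = Z) \<and> (\<forall>g\<in>elts M. app s g = A \<and> app t g = Z \<longrightarrow> g = f))
          \<and> (\<exists>f\<in>elts M. (app s f = Z \<and> app t f = A) \<and> (\<forall>g\<in>elts M. app s g = Z \<and> app t g = A \<longrightarrow> g = f)))"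

definition iso_formula :: "'u::set_universe \<Rightarrow> 'u \<Rightarrow> 'u \<Rightarrow> 'u \<Rightarrow> 'u \<Rightarrow> bool" where
  "iso_formula M s t c f \<longleftrightarrow> (\<exists>g\<in>elts M. app s g = app t f \<and> app t g = app s f
     \<and> app c (pair f g) = app s f \<and> app c (pair g f) = app t f)"

context set_category
begin

notation cmp (infixr "\<cdot>" 75)

text \<open>A triple is a pair whose first component is a pair, so \<open>c\<close> can be applied to pairs.\<close>

lemma app_comp:
  assumes "f \<in> elts M" "g \<in> elts M" "app t f = app s g"
  shows "app c (pair f g) = g \<cdot> f"
  using comp_unique[OF assms] by (simp add: cmp_def triple_def app_eq)

lemma zero_object_iff: "zero_object Z \<longleftrightarrow> Z \<in> elts M \<and> zero_object_formula M s t Z"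
proof -
  have "(\<exists>!f. f \<in> Hom A B) \<longleftrightarrow> (\<exists>f\<in>elts M. (app s f = A \<and> app t f = B)
      \<and> (\<forall>g\<in>elts M. app s g = A \<and> app t g = B \<longrightarrow> g = f))" for A B
    unfolding Hom_def by blast
  then show ?thesis
    unfolding zero_object_def zero_object_formula_def Obj_def by auto
qed

lemma iso_iff:
  assumes "f \<in> elts M"
  shows "iso f \<longleftrightarrow> iso_formula M s t c f"
proof -
  have "g \<cdot> f = app c (pair f g) \<and> f \<cdot> g = app c (pair g f)"
    if "g \<in> elts M" "app s g = app t f" "app t g = app s f" for g
    using that assms app_comp by simp
  then show ?thesis
    unfolding iso_def iso_formula_def Hom_def using assms by auto
qed

end

section \<open>Additive categories\<close>

text \<open>The axioms for the addition relation, in bounded form.\<close>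

definition sum_sentence :: "'u::set_universe \<Rightarrow> 'u \<Rightarrow> 'u \<Rightarrow> 'u \<Rightarrow> bool" where
  "sum_sentence M s t P \<longleftrightarrow>
     (\<forall>f\<in>elts M. \<forall>g\<in>elts M. \<forall>h\<in>elts M. triple f g h \<in> elts P \<longrightarrow>
        app s f = app s g \<and> app t f = app t g \<and> app s h = app s f \<and> app t h = app t f)
     \<and> (\<forall>f\<in>elts M. \<forall>g\<in>elts M. app s f = app s g \<and> app t f = app t g \<longrightarrow>
          (\<exists>h\<in>elts M. triple f g h \<in> elts P \<and> (\<forall>h'\<in>elts M. triple f g h' \<in> elts P \<longrightarrow> h' = h)))"

lemma (in set_category) category_with_sum_iff:
  assumes "is_rel3 M P"
  shows "category_with_sum (elts M) (app s) (app t) (rel3 c) (rel3 P) \<longleftrightarrow> sum_sentence M s t P"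
proof -
  note D = is_rel3_D[OF assms]
  have ex1: "(\<exists>!h. triple f g h \<in> elts P)
    \<longleftrightarrow> (\<exists>h\<in>elts M. triple f g h \<in> elts P \<and> (\<forall>h'\<in>elts M. triple f g h' \<in> elts P \<longrightarrow> h' = h))" for f g
    by (rule bounded_ex1) (use D in blast)
  show ?thesis
  proof
    assume "category_with_sum (elts M) (app s) (app t) (rel3 c) (rel3 P)"
    then interpret category_with_sum "elts M" "app s" "app t" "rel3 c" "rel3 P" .
    show "sum_sentence M s t P"
      unfolding sum_sentence_def ex1[symmetric]
      using sum_typing sum_unique unfolding rel3_iff by blast
  next
    assume "sum_sentence M s t P"
    note C = this[unfolded sum_sentence_def ex1[symmetric]]
    show "category_with_sum (elts M) (app s) (app t) (rel3 c) (rel3 P)"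
    proof (unfold_locales, unfold rel3_iff)
      fix f g h
      assume fgh: "triple f g h \<in> elts P"
      then show "f \<in> elts M \<and> g \<in> elts M \<and> h \<in> elts M
          \<and> app s f = app s g \<and> app t f = app t g \<and> app s h = app s f \<and> app t h = app t f"
        using C[THEN conjunct1] D[OF fgh] by blast
    qed (use C[THEN conjunct2] in blast)
  qed
qed

context category_with_sum
begin

lemma add_in:
  assumes "f \<in> M" "g \<in> M" "s f = s g" "t f = t g"
  shows "f \<oplus> g \<in> M" "s (f \<oplus> g) = s f" "t (f \<oplus> g) = t f"
proof -
  have "(f, g, f \<oplus> g) \<in> P"
    unfolding add_def using sum_unique[OF assms] by (rule theI')
  then show "f \<oplus> g \<in> M" "s (f \<oplus> g) = s f" "t (f \<oplus> g) = t f"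
    using sum_typing by auto
qed

lemma add_Hom: "f \<in> Hom A B \<Longrightarrow> g \<in> Hom A B \<Longrightarrow> f \<oplus> g \<in> Hom A B"
  by (simp add: Hom_def add_in)

lemma zero_eqI:
  assumes z: "z \<in> Hom A B" and neutral: "\<And>f. f \<in> Hom A B \<Longrightarrow> z \<oplus> f = f \<and> f \<oplus> z = f"
  shows "zero A B = z"
  unfolding zero_def
proof (rule the_equality)
  show "z \<in> Hom A B \<and> (\<forall>f\<in>Hom A B. z \<oplus> f = f \<and> f \<oplus> z = f)"
    using assms by blast
  show "z' = z" if "z' \<in> Hom A B \<and> (\<forall>f\<in>Hom A B. z' \<oplus> f = f \<and> f \<oplus> z' = f)" for z'
    using that assms by metis
qed

text \<open>
  The right-hand side does not mention the zero morphism, which is a definite description.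
\<close>

lemma comm_group_hom_iff:
  "comm_group (hom_group A B) \<longleftrightarrow>
     (\<forall>f\<in>Hom A B. \<forall>g\<in>Hom A B. f \<oplus> g = g \<oplus> f \<and> (\<forall>h\<in>Hom A B. (f \<oplus> g) \<oplus> h = f \<oplus> (g \<oplus> h)))
     \<and> (\<exists>z\<in>Hom A B. \<forall>f\<in>Hom A B. z \<oplus> f = f \<and> (\<exists>g\<in>Hom A B. g \<oplus> f = z))"
  (is "_ \<longleftrightarrow> ?group")
proof
  assume "comm_group (hom_group A B)"
  then interpret comm_group "hom_group A B" .
  show ?group
  proof (intro conjI ballI)
    fix f g h assume "f \<in> Hom A B" "g \<in> Hom A B" "h \<in> Hom A B"
    then show "f \<oplus> g \<oplus> h = f \<oplus> (g \<oplus> h)"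
      using m_assoc[of f g h] by (simp add: hom_group_def)
  next
    fix f g assume "f \<in> Hom A B" "g \<in> Hom A B"
    then show "f \<oplus> g = g \<oplus> f"
      using m_comm[of f g] by (simp add: hom_group_def)
  next
    show "\<exists>z\<in>Hom A B. \<forall>f\<in>Hom A B. z \<oplus> f = f \<and> (\<exists>g\<in>Hom A B. g \<oplus> f = z)"
    proof (rule bexI[of _ "zero A B"], intro ballI conjI)
      fix f assume "f \<in> Hom A B"
      then show "zero A B \<oplus> f = f" "\<exists>g\<in>Hom A B. g \<oplus> f = zero A B"
        using l_one[of f] l_inv_ex[of f] by (simp_all add: hom_group_def)
    qed (use one_closed in \<open>simp add: hom_group_def\<close>)
  qed
next
  assume G: ?group
  then obtain z where z: "z \<in> Hom A B" "\<forall>f\<in>Hom A B. z \<oplus> f = f \<and> (\<exists>g\<in>Hom A B. g \<oplus> f = z)"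
    by blast
  have "zero A B = z"
    using z G by (intro zero_eqI) auto
  then show "comm_group (hom_group A B)"
    using z G add_Hom by (intro comm_groupI; simp add: hom_group_def; blast)
qed

text \<open>The zero of a group is its only idempotent.\<close>

lemma idem_iff_zero:
  assumes "comm_group (hom_group A B)" "f \<in> Hom A B"
  shows "f \<oplus> f = f \<longleftrightarrow> f = zero A B"
proof -
  interpret comm_group "hom_group A B" by fact
  show ?thesis
    using r_cancel_one'[of f f] r_cancel_one[of f f] assms(2) by (auto simp: hom_group_def)
qed

text \<open>Likewise the inverse of \<open>f\<close> is characterised without reference to the neutral element.\<close>

lemma neg_iff:
  assumes "comm_group (hom_group (s f) (t f))" "f \<in> M" "g \<in> Hom (s f) (t f)"
  shows "(f \<oplus> g) \<oplus> f = f \<longleftrightarrow> g = neg f"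
proof -
  let ?G = "hom_group (s f) (t f)"
  interpret comm_group ?G by fact
  have f: "f \<in> carrier ?G" and g: "g \<in> carrier ?G"
    using assms(2,3) by (simp_all add: hom_group_def Hom_def)
  have "(f \<otimes>\<^bsub>?G\<^esub> g) \<otimes>\<^bsub>?G\<^esub> f = f \<longleftrightarrow> f \<otimes>\<^bsub>?G\<^esub> g = \<one>\<^bsub>?G\<^esub>"
    using f g by (metis l_one m_closed one_closed right_cancel)
  also have "\<dots> \<longleftrightarrow> g = inv\<^bsub>?G\<^esub> f"
    using f g by (metis inv_equality m_comm r_inv)
  finally show ?thesis
    by (simp add: hom_group_def neg_def)
qed

lemma neg_in:
  assumes "comm_group (hom_group (s f) (t f))" "f \<in> M"
  shows "neg f \<in> Hom (s f) (t f)"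
proof -
  interpret comm_group "hom_group (s f) (t f)" by fact
  show ?thesis
    using inv_closed[of f] assms(2) by (simp add: hom_group_def Hom_def neg_def)
qed

end

locale set_category_with_sum = set_category +
  fixes P :: 'a
  assumes sum_rel: "is_rel3 M P"
    and is_category_with_sum: "category_with_sum (elts M) (app s) (app t) (rel3 c) (rel3 P)"

sublocale set_category_with_sum \<subseteq> category_with_sum "elts M" "app s" "app t" "rel3 c" "rel3 P"
  by (rule is_category_with_sum)

text \<open>
  The axioms of an additive category in bounded form. In the clause for biproducts the two
  mixed composites are required to be idempotent under addition, that is, to be zero.
\<close>

definition additive_sentence :: "'u::set_universe \<Rightarrow> 'u \<Rightarrow> 'u \<Rightarrow> 'u \<Rightarrow> 'u \<Rightarrow> bool" where
  "additive_sentence M s t c P \<longleftrightarrow>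
     (\<forall>A\<in>elts M. \<forall>B\<in>elts M. app s A = A \<and> app s B = B \<longrightarrow>
        (\<forall>f\<in>elts M. app s f = A \<and> app t f = B \<longrightarrow> (\<forall>g\<in>elts M. app s g = A \<and> app t g = B \<longrightarrow>
           app P (pair f g) = app P (pair g f)
           \<and> (\<forall>h\<in>elts M. app s h = A \<and> app t h = B \<longrightarrow>
                app P (pair (app P (pair f g)) h) = app P (pair f (app P (pair g h))))))
        \<and> (\<exists>z\<in>elts M. (app s z = A \<and> app t z = B)
             \<and> (\<forall>f\<in>elts M. app s f = A \<and> app t f = B \<longrightarrow> app P (pair z f) = f
                  \<and> (\<exists>g\<in>elts M. (app s g = A \<and> app t g = B) \<and> app P (pair g f) = z))))
     \<and> (\<forall>f\<in>elts M. \<forall>f'\<in>elts M. \<forall>g\<in>elts M.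
          app s f' = app s f \<and> app t f' = app t f \<and> app s g = app t f \<longrightarrow>
          app c (pair (app P (pair f f')) g) = app P (pair (app c (pair f g)) (app c (pair f' g))))
     \<and> (\<forall>f\<in>elts M. \<forall>g\<in>elts M. \<forall>g'\<in>elts M.
          app s g = app t f \<and> app s g' = app t f \<and> app t g' = app t g \<longrightarrow>
          app c (pair f (app P (pair g g'))) = app P (pair (app c (pair f g)) (app c (pair f g'))))
     \<and> (\<exists>Z\<in>elts M. zero_object_formula M s t Z)
     \<and> (\<forall>A\<in>elts M. \<forall>B\<in>elts M. app s A = A \<and> app s B = B \<longrightarrow>
          (\<exists>C\<in>elts M. app s C = C
           \<and> (\<exists>i\<in>elts M. (app s i = A \<and> app t i = C)
           \<and> (\<exists>j\<in>elts M. (app s j = B \<and> app t j = C)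
           \<and> (\<exists>p\<in>elts M. (app s p = C \<and> app t p = A)
           \<and> (\<exists>q\<in>elts M. (app s q = C \<and> app t q = B)
           \<and> app c (pair i p) = A \<and> app c (pair j q) = B
           \<and> app P (pair (app c (pair i q)) (app c (pair i q))) = app c (pair i q)
           \<and> app P (pair (app c (pair j p)) (app c (pair j p))) = app c (pair j p)
           \<and> app P (pair (app c (pair p i)) (app c (pair q j))) = C))))))"

context set_category_with_sum
begin

notation add (infixl "\<oplus>" 65)

lemma app_sum:
  assumes "f \<in> elts M" "g \<in> elts M" "app s f = app s g" "app t f = app t g"
  shows "app P (pair f g) = f \<oplus> g"
  using sum_unique[OF assms] by (simp add: add_def triple_def app_eq)

lemma hom_group_formula:
  "comm_group (hom_group A B) \<longleftrightarrow>
     (\<forall>f\<in>elts M. app s f = A \<and> app t f = B \<longrightarrow> (\<forall>g\<in>elts M. app s g = A \<and> app t g = B \<longrightarrow>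
        app P (pair f g) = app P (pair g f)
        \<and> (\<forall>h\<in>elts M. app s h = A \<and> app t h = B \<longrightarrow>
             app P (pair (app P (pair f g)) h) = app P (pair f (app P (pair g h))))))
     \<and> (\<exists>z\<in>elts M. (app s z = A \<and> app t z = B)
          \<and> (\<forall>f\<in>elts M. app s f = A \<and> app t f = B \<longrightarrow> app P (pair z f) = f
               \<and> (\<exists>g\<in>elts M. (app s g = A \<and> app t g = B) \<and> app P (pair g f) = z)))"
  unfolding comm_group_hom_iff Ball_Hom Bex_Hom
  by (simp add: app_sum add_in cong: conj_cong ball_cong_simp bex_cong_simp)

lemma biproduct_formula:
  assumes "comm_group (hom_group A B)" "comm_group (hom_group B A)"
  shows "(\<exists>C\<in>Obj. \<exists>i\<in>Hom A C. \<exists>j\<in>Hom B C. \<exists>p\<in>Hom C A. \<exists>q\<in>Hom C B.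
      p \<cdot> i = A \<and> q \<cdot> j = B \<and> q \<cdot> i = zero A B \<and> p \<cdot> j = zero B A \<and> (i \<cdot> p) \<oplus> (j \<cdot> q) = C) \<longleftrightarrow>
    (\<exists>C\<in>elts M. app s C = C
      \<and> (\<exists>i\<in>elts M. (app s i = A \<and> app t i = C)
      \<and> (\<exists>j\<in>elts M. (app s j = B \<and> app t j = C)
      \<and> (\<exists>p\<in>elts M. (app s p = C \<and> app t p = A)
      \<and> (\<exists>q\<in>elts M. (app s q = C \<and> app t q = B)
      \<and> app c (pair i p) = A \<and> app c (pair j q) = B
      \<and> app P (pair (app c (pair i q)) (app c (pair i q))) = app c (pair i q)
      \<and> app P (pair (app c (pair j p)) (app c (pair j p))) = app c (pair j p)
      \<and> app P (pair (app c (pair p i)) (app c (pair q j))) = C)))))"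
proof -
  note idem = idem_iff_zero[OF assms(1), unfolded Hom_def] idem_iff_zero[OF assms(2), unfolded Hom_def]
  show ?thesis
    unfolding Bex_Obj Bex_Hom
    by (simp add: app_comp app_sum add_in cmp_in idem cong: conj_cong bex_cong_simp)
qed

lemma additive_iff:
  "additive_category (elts M) (app s) (app t) (rel3 c) (rel3 P) \<longleftrightarrow> additive_sentence M s t c P"
proof
  assume "additive_category (elts M) (app s) (app t) (rel3 c) (rel3 P)"
  then interpret additive_category "elts M" "app s" "app t" "rel3 c" "rel3 P" .
  show "additive_sentence M s t c P"
    unfolding additive_sentence_def hom_group_formula[symmetric]
  proof (intro conjI ballI impI, goal_cases)
    case (1 A B)
    then show ?case by (simp add: hom_comm_group Obj_def)
  next
    case (2 f f' g)
    then show ?case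
      using distrib_left[of f "app s f" "app t f" f' g "app t g"]
      by (simp add: Hom_def app_comp app_sum add_in cmp_in)
  next
    case (3 f g g')
    then show ?case
      using distrib_right[of f "app s f" "app t f" g "app t g" g']
      by (simp add: Hom_def app_comp app_sum add_in cmp_in)
  next
    case 4
    then show ?case using zero_object_exists zero_object_iff by blast
  next
    case (5 A B)
    then have "A \<in> Obj" "B \<in> Obj" by (auto simp: Obj_def)
    then show ?case
      using biproduct_exists[of A B] biproduct_formula[of A B] hom_comm_group by blast
  qed
next
  assume "additive_sentence M s t c P"
  note C = this[unfolded additive_sentence_def hom_group_formula[symmetric]]
  have group: "comm_group (hom_group A B)" if "A \<in> Obj" "B \<in> Obj" for A B
    using C[THEN conjunct1] that unfolding Obj_def by blast
  show "additive_category (elts M) (app s) (app t) (rel3 c) (rel3 P)"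
  proof (intro additive_category.intro is_category_with_sum additive_category_axioms.intro, goal_cases)
    case (1 A B)
    then show ?case by (rule group)
  next
    case (2 f A B f' g C')
    then show ?case
      using C[THEN conjunct2, THEN conjunct1, rule_format, of f f' g]
      by (simp add: Hom_def app_comp app_sum add_in cmp_in)
  next
    case (3 f A B g C' g')
    then show ?case
      using C[THEN conjunct2, THEN conjunct2, THEN conjunct1, rule_format, of f g g']
      by (simp add: Hom_def app_comp app_sum add_in cmp_in)
  next
    case 4
    then show ?case using C zero_object_iff by blast
  next
    case (5 A B)
    show ?case
      unfolding biproduct_formula[OF group[OF 5] group[OF 5(2,1)]]
      using C[THEN conjunct2, THEN conjunct2, THEN conjunct2, THEN conjunct2] 5 unfolding Obj_def by blast
  qed
qed

end

locale set_additive_category = set_category_with_sum +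
  assumes is_additive: "additive_category (elts M) (app s) (app t) (rel3 c) (rel3 P)"

sublocale set_additive_category \<subseteq> additive_category "elts M" "app s" "app t" "rel3 c" "rel3 P"
  by (rule is_additive)

section \<open>Triangulated categories\<close>

text \<open>
  The axioms for the shift in bounded form. That \<open>Sig\<close> maps \<open>M\<close> to \<open>M\<close> is part of its being a map.
\<close>

definition shift_sentence :: "'u::set_universe \<Rightarrow> 'u \<Rightarrow> 'u \<Rightarrow> 'u \<Rightarrow> 'u \<Rightarrow> bool" where
  "shift_sentence M s t c Sig \<longleftrightarrow>
     (\<forall>f\<in>elts M. app Sig (app s f) = app s (app Sig f) \<and> app Sig (app t f) = app t (app Sig f))
     \<and> (\<forall>f\<in>elts M. \<forall>g\<in>elts M. app Sig f = app Sig g \<longrightarrow> f = g)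
     \<and> (\<forall>g\<in>elts M. \<exists>f\<in>elts M. g = app Sig f)
     \<and> (\<forall>f\<in>elts M. \<forall>g\<in>elts M. \<forall>h\<in>elts M. triple f g h \<in> elts c \<longrightarrow>
          triple (app Sig f) (app Sig g) (app Sig h) \<in> elts c)"

lemma (in set_additive_category) additive_with_shift_iff:
  assumes "is_map M M Sig"
  shows "additive_category_with_shift (elts M) (app s) (app t) (rel3 c) (rel3 P) (app Sig)
    \<longleftrightarrow> shift_sentence M s t c Sig"
proof
  assume "additive_category_with_shift (elts M) (app s) (app t) (rel3 c) (rel3 P) (app Sig)"
  then interpret additive_category_with_shift "elts M" "app s" "app t" "rel3 c" "rel3 P" "app Sig" .
  show "shift_sentence M s t c Sig"
    using shift_bij shift_src shift_tgt shift_comp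
    unfolding shift_sentence_def bij_betw_def inj_on_def rel3_iff by blast
next
  assume "shift_sentence M s t c Sig"
  note C = this[unfolded shift_sentence_def]
  have "bij_betw (app Sig) (elts M) (elts M)"
    using C app_in[OF assms] unfolding bij_betw_def inj_on_def by blast
  moreover have "triple (app Sig f) (app Sig g) (app Sig h) \<in> elts c" if "triple f g h \<in> elts c" for f g h
    using C that is_rel3_D[OF comp_rel that] by blast
  ultimately show "additive_category_with_shift (elts M) (app s) (app t) (rel3 c) (rel3 P) (app Sig)"
    using C by (intro additive_category_with_shift.intro is_additive
        additive_category_with_shift_axioms.intro) (unfold rel3_iff, blast+)
qed

locale set_additive_category_with_shift = set_additive_category +
  fixes Sig :: 'a
  assumes shift_map: "is_map M M Sig"
    and is_shift: "additive_category_with_shift (elts M) (app s) (app t) (rel3 c) (rel3 P) (app Sig)"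

sublocale set_additive_category_with_shift \<subseteq>
    additive_category_with_shift "elts M" "app s" "app t" "rel3 c" "rel3 P" "app Sig"
  by (rule is_shift)

text \<open>
  Bounded forms of the notions of a triangle and of a morphism of triangles, for data in \<open>M\<close>.
\<close>

definition triangle_formula :: "'u::set_universe \<Rightarrow> 'u \<Rightarrow> 'u \<Rightarrow> 'u \<Rightarrow> 'u \<Rightarrow> 'u \<Rightarrow> bool" where
  "triangle_formula s t Sig f g h \<longleftrightarrow>
     app t f = app s g \<and> app t g = app s h \<and> app t h = app Sig (app s f)"

definition triangle_mor_formula ::
    "'u::set_universe \<Rightarrow> 'u \<Rightarrow> 'u \<Rightarrow> 'u \<Rightarrow> 'u \<Rightarrow> 'u \<Rightarrow> 'u \<Rightarrow> 'u \<Rightarrow> 'u \<Rightarrow> 'u \<Rightarrow> 'u \<Rightarrow> 'u \<Rightarrow> 'u \<Rightarrow> bool"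
  where
  "triangle_mor_formula s t c Sig f g h f' g' h' u v w \<longleftrightarrow>
     (app s u = app s f \<and> app t u = app s f')
     \<and> (app s v = app s g \<and> app t v = app s g')
     \<and> (app s w = app s h \<and> app t w = app s h')
     \<and> app c (pair f v) = app c (pair u f')
     \<and> app c (pair g w) = app c (pair v g')
     \<and> app c (pair h (app Sig u)) = app c (pair w h')"

text \<open>
  Verdier's axioms in bounded form. In the third clause \<open>f\<close> and \<open>g\<close> are arbitrary morphisms to
  and from a zero object, which makes them zero morphisms; in the fifth the equation for \<open>k\<close> says
  that \<open>k\<close> is the negative of the shift of \<open>f\<close>.
\<close>

definition triangulated_sentence ::
    "'u::set_universe \<Rightarrow> 'u \<Rightarrow> 'u \<Rightarrow> 'u \<Rightarrow> 'u \<Rightarrow> 'u \<Rightarrow> 'u \<Rightarrow> bool" where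
  "triangulated_sentence M s t c P Sig D \<longleftrightarrow>
     (\<forall>f\<in>elts M. \<forall>g\<in>elts M. \<forall>h\<in>elts M. triple f g h \<in> elts D \<longrightarrow> triangle_formula s t Sig f g h)
     \<and> (\<forall>f\<in>elts M. \<forall>g\<in>elts M. \<forall>h\<in>elts M. \<forall>f'\<in>elts M. \<forall>g'\<in>elts M. \<forall>h'\<in>elts M.
          \<forall>u\<in>elts M. \<forall>v\<in>elts M. \<forall>w\<in>elts M.
          triple f g h \<in> elts D \<and> triangle_formula s t Sig f' g' h'
          \<and> triangle_mor_formula s t c Sig f g h f' g' h' u v w
          \<and> iso_formula M s t c u \<and> iso_formula M s t c v \<and> iso_formula M s t c w \<longrightarrow>
          triple f' g' h' \<in> elts D)
     \<and> (\<forall>A\<in>elts M. \<forall>Z\<in>elts M. \<forall>f\<in>elts M. \<forall>g\<in>elts M.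
          app s A = A \<and> zero_object_formula M s t Z
          \<and> (app s f = A \<and> app t f = Z) \<and> (app s g = Z \<and> app t g = app Sig A) \<longrightarrow>
          triple A f g \<in> elts D)
     \<and> (\<forall>f\<in>elts M. \<exists>g\<in>elts M. \<exists>h\<in>elts M. triple f g h \<in> elts D)
     \<and> (\<forall>f\<in>elts M. \<forall>g\<in>elts M. \<forall>h\<in>elts M. \<forall>k\<in>elts M.
          triangle_formula s t Sig f g h
          \<and> (app s k = app s (app Sig f) \<and> app t k = app t (app Sig f))
          \<and> app P (pair (app P (pair (app Sig f) k)) (app Sig f)) = app Sig f \<longrightarrow>
          (triple f g h \<in> elts D \<longleftrightarrow> triple g h k \<in> elts D))
     \<and> (\<forall>f\<in>elts M. \<forall>g\<in>elts M. \<forall>h\<in>elts M. \<forall>f'\<in>elts M. \<forall>g'\<in>elts M. \<forall>h'\<in>elts M.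
          \<forall>u\<in>elts M. \<forall>v\<in>elts M.
          triple f g h \<in> elts D \<and> triple f' g' h' \<in> elts D
          \<and> (app s u = app s f \<and> app t u = app s f') \<and> (app s v = app s g \<and> app t v = app s g')
          \<and> app c (pair f v) = app c (pair u f') \<longrightarrow>
          (\<exists>w\<in>elts M. triangle_mor_formula s t c Sig f g h f' g' h' u v w))
     \<and> (\<forall>f\<in>elts M. \<forall>f'\<in>elts M. \<forall>f''\<in>elts M. \<forall>g\<in>elts M. \<forall>g'\<in>elts M. \<forall>g''\<in>elts M.
          \<forall>h'\<in>elts M. \<forall>h''\<in>elts M.
          app t f = app s g \<and> triple f f' f'' \<in> elts D \<and> triple g g' g'' \<in> elts D
          \<and> triple (app c (pair f g)) h' h'' \<in> elts D \<longrightarrow>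
          (\<exists>u\<in>elts M. (app s u = app s f'' \<and> app t u = app s h'')
            \<and> (\<exists>v\<in>elts M. (app s v = app s h'' \<and> app t v = app s g'')
            \<and> triple u v (app c (pair g'' (app Sig f'))) \<in> elts D
            \<and> app c (pair f' u) = app c (pair g h')
            \<and> app c (pair u h'') = f''
            \<and> app c (pair h' v) = g'
            \<and> app c (pair v g'') = app c (pair h'' (app Sig f)))))"

context set_additive_category_with_shift
begin

lemma shift_in: "f \<in> elts M \<Longrightarrow> app Sig f \<in> elts M"
  by (rule app_in[OF shift_map])

lemma triangle_iff: "triangle (f, g, h) \<longleftrightarrow>
    f \<in> elts M \<and> g \<in> elts M \<and> h \<in> elts M \<and> triangle_formula s t Sig f g h"
  by (simp add: triangle_def triangle_formula_def)

lemma triangle_mor_iff: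
  assumes "triangle (f, g, h)" "triangle (f', g', h')"
  shows "triangle_mor (f, g, h) (f', g', h') (u, v, w) \<longleftrightarrow>
    u \<in> elts M \<and> v \<in> elts M \<and> w \<in> elts M \<and> triangle_mor_formula s t c Sig f g h f' g' h' u v w"
  using assms unfolding triangle_iff triangle_formula_def
  by (auto simp: triangle_mor_def triangle_mor_formula_def Hom_def app_comp shift_in
      shift_src[symmetric] shift_tgt[symmetric])

lemma square_formula:
  assumes "triangle (f, g, h)" "triangle (f', g', h')"
    and "u \<in> Hom (app s f) (app s f')" "v \<in> Hom (app s g) (app s g')"
  shows "v \<cdot> f = f' \<cdot> u \<longleftrightarrow> app c (pair f v) = app c (pair u f')"
  using assms by (simp add: triangle_iff triangle_formula_def Hom_def app_comp)

lemma zero_in: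
  assumes "A \<in> Obj" "B \<in> Obj"
  shows "zero A B \<in> Hom A B"
proof -
  interpret G: comm_group "hom_group A B"
    using assms by (rule hom_comm_group)
  show ?thesis
    using G.one_closed by (simp add: hom_group_def)
qed

lemma zero_object_Hom:
  assumes "zero_object Z" "A \<in> Obj"
  shows "f \<in> Hom A Z \<longleftrightarrow> f = zero A Z" "f \<in> Hom Z A \<longleftrightarrow> f = zero Z A"
  using assms zero_in[of A Z] zero_in[of Z A] unfolding zero_object_def by blast+

lemma neg_formula:
  assumes "f \<in> elts M" "g \<in> elts M" "app s g = app s f" "app t g = app t f"
  shows "app P (pair (app P (pair f g)) f) = f \<longleftrightarrow> g = neg f"
proof -
  have "app P (pair (app P (pair f g)) f) = f \<oplus> g \<oplus> f"
    using assms by (simp add: app_sum add_in)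
  then show ?thesis
    using neg_iff[of f g] hom_comm_group src_tgt_Obj assms by (simp add: Hom_def)
qed

text \<open>The conclusion of the octahedral axiom in bounded form.\<close>

lemma octahedron_formula:
  assumes "triangle (f, f', f'')" "triangle (g, g', g'')" "triangle (g \<cdot> f, h', h'')" "app t f = app s g"
  shows "(\<exists>u\<in>Hom (app s f'') (app s h''). \<exists>v\<in>Hom (app s h'') (app s g'').
      (u, v, app Sig f' \<cdot> g'') \<in> rel3 D \<and> u \<cdot> f' = h' \<cdot> g \<and> h'' \<cdot> u = f'' \<and> v \<cdot> h' = g'
      \<and> g'' \<cdot> v = app Sig f \<cdot> h'') \<longleftrightarrow>
    (\<exists>u\<in>elts M. (app s u = app s f'' \<and> app t u = app s h'')
      \<and> (\<exists>v\<in>elts M. (app s v = app s h'' \<and> app t v = app s g'')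
      \<and> triple u v (app c (pair g'' (app Sig f'))) \<in> elts D
      \<and> app c (pair f' u) = app c (pair g h')
      \<and> app c (pair u h'') = f''
      \<and> app c (pair h' v) = g'
      \<and> app c (pair v g'') = app c (pair h'' (app Sig f))))"
  using assms unfolding Bex_Hom triangle_iff triangle_formula_def
  by (simp add: app_comp cmp_in shift_in shift_src[symmetric] shift_tgt[symmetric]
      cong: conj_cong bex_cong_simp)

lemma triangulated_iff:
  assumes "is_rel3 M D"
  shows "triangulated_category (elts M) (app s) (app t) (rel3 c) (rel3 P) (app Sig) (rel3 D)
    \<longleftrightarrow> triangulated_sentence M s t c P Sig D"
proof
  note D = is_rel3_D[OF assms]
  assume "triangulated_category (elts M) (app s) (app t) (rel3 c) (rel3 P) (app Sig) (rel3 D)"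
  then interpret triangulated_category "elts M" "app s" "app t" "rel3 c" "rel3 P" "app Sig" "rel3 D" .
  have dist: "triangle (f, g, h)" if "triple f g h \<in> elts D" for f g h
    using distinguished_triangle[of "(f, g, h)"] that by simp
  show "triangulated_sentence M s t c P Sig D"
    unfolding triangulated_sentence_def
  proof (intro conjI ballI impI, goal_cases)
    case (1 f g h)
    then show ?case using dist triangle_iff by blast
  next
    case (2 f g h f' g' h' u v w)
    then have "triangle (f', g', h')" "triangle (f, g, h)"
      using dist triangle_iff by blast+
    with 2 show ?case
      using TR1_iso[of f g h f' g' h' u v w] by (simp add: triangle_mor_iff iso_iff)
  next
    case (3 A Z f g)
    then have "A \<in> Obj" "app Sig A \<in> Obj" "zero_object Z"
      by (auto simp: Obj_def zero_object_iff shift_in shift_src[symmetric])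
    moreover from this 3 have "f = zero A Z" "g = zero Z (app Sig A)"
      using zero_object_Hom by (simp_all add: Hom_def flip: zero_object_Hom)
    ultimately show ?case
      using TR1_id[of A Z] by simp
  next
    case (4 f)
    then show ?case using TR1_cone[of f] D unfolding rel3_iff by blast
  next
    case (5 f g h k)
    then have "k = neg (app Sig f)"
      using neg_formula[of "app Sig f" k] shift_in by blast
    then show ?case
      using 5 TR2[of f g h] triangle_iff by simp
  next
    case (6 f g h f' g' h' u v)
    then have "triangle (f, g, h)" "triangle (f', g', h')"
      using dist by blast+
    note mor = triangle_mor_iff[OF this] and square = square_formula[OF this]
    show ?case
      using TR3[of f g h f' g' h' u v] square[of u v, unfolded Hom_def] 6
      unfolding mor rel3_iff Hom_def by blast
  next
    case (7 f f' f'' g g' g'' h' h'')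
    then have "triple (g \<cdot> f) h' h'' \<in> elts D"
      using app_comp[of f g] by simp
    with 7 show ?case
      using TR4[of f g f' f'' g' g'' h' h''] octahedron_formula[of f f' f'' g g' g'' h' h'' D] dist
      unfolding rel3_iff by blast
  qed
next
  note D = is_rel3_D[OF assms]
  assume "triangulated_sentence M s t c P Sig D"
  note ax = this[unfolded triangulated_sentence_def]
  note typing = ax[THEN conjunct1] and ax = ax[THEN conjunct2]
  note iso_closed = ax[THEN conjunct1] and ax = ax[THEN conjunct2]
  note identity = ax[THEN conjunct1] and ax = ax[THEN conjunct2]
  note cone = ax[THEN conjunct1] and ax = ax[THEN conjunct2]
  note rotation = ax[THEN conjunct1] and ax = ax[THEN conjunct2]
  note completion = ax[THEN conjunct1] and octahedron = ax[THEN conjunct2]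
  have dist: "triangle (f, g, h)" if "triple f g h \<in> elts D" for f g h
    using typing D[OF that] that triangle_iff by blast
  show "triangulated_category (elts M) (app s) (app t) (rel3 c) (rel3 P) (app Sig) (rel3 D)"
  proof (intro triangulated_category.intro triangulated_category_axioms.intro is_shift,
      unfold rel3_iff, goal_cases)
    case (1 T)
    then show ?case using dist by (cases T) simp
  next
    case (2 f g h f' g' h' u v w)
    then show ?case
      using iso_closed[rule_format, of f g h f' g' h' u v w] dist[of f g h]
      by (simp add: triangle_mor_iff) (simp add: triangle_iff iso_iff)
  next
    case (3 A Z)
    then have objs: "A \<in> Obj" "Z \<in> Obj" "app Sig A \<in> Obj"
      by (auto simp: Obj_def zero_object_def shift_in shift_src[symmetric])
    show ?case
      using identity[rule_format, of A Z "zero A Z" "zero Z (app Sig A)"] 3 objs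
        zero_in[of A Z] zero_in[of Z "app Sig A"]
      by (simp add: Hom_def zero_object_iff Obj_def)
  next
    case (4 f)
    then show ?case using cone by blast
  next
    case (5 f g h)
    then have "app Sig f \<in> elts M"
      using shift_in triangle_iff by blast
    moreover from this have "neg (app Sig f) \<in> Hom (app s (app Sig f)) (app t (app Sig f))"
      using neg_in hom_comm_group src_tgt_Obj by blast
    ultimately show ?case
      using rotation[rule_format, of f g h "neg (app Sig f)"] 5 neg_formula[of "app Sig f" "neg (app Sig f)"]
      unfolding triangle_iff Hom_def by blast
  next
    case (6 f g h f' g' h' u v)
    then have "triangle (f, g, h)" "triangle (f', g', h')"
      using dist by blast+
    note mor = triangle_mor_iff[OF this] and square = square_formula[OF this]
    show ?case
      using completion[rule_format, of f g h f' g' h' u v] square[of u v, unfolded Hom_def]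
        6 dist[OF 6(1)] dist[OF 6(2)]
      unfolding mor triangle_iff Hom_def by blast
  next
    case (7 f g f' f'' g' g'' h' h'')
    note tri = dist[OF 7(2)] dist[OF 7(3)] dist[OF 7(4)]
    have "f \<in> elts M \<and> f' \<in> elts M \<and> f'' \<in> elts M \<and> g \<in> elts M \<and> g' \<in> elts M \<and> g'' \<in> elts M
        \<and> h' \<in> elts M \<and> h'' \<in> elts M"
      using tri unfolding triangle_iff by blast
    moreover from this have "triple (app c (pair f g)) h' h'' \<in> elts D"
      using 7 by (simp add: app_comp)
    ultimately show ?case
      unfolding octahedron_formula[OF tri 7(1), of D, unfolded rel3_iff] using octahedron 7 by blast
  qed
qed

end

section \<open>Enlargements of triangulated categories\<close>

lemmas sentence_defs = category_sentence_def sum_sentence_def additive_sentence_def shift_sentence_def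
  triangulated_sentence_def zero_object_formula_def iso_formula_def triangle_formula_def
  triangle_mor_formula_def

context
  fixes S W :: "'u::set_universe" and star :: "'u \<Rightarrow> 'u" and M s t c :: 'u
  assumes enl: "enlargement S W star"
    and M: "M \<in> superstructure S" and s: "s \<in> superstructure S" and t: "t \<in> superstructure S"
    and c: "c \<in> superstructure S"
begin

lemma category_sentence_transfer:
  "category_sentence M s t c \<longleftrightarrow> category_sentence (star M) (star s) (star t) (star c)"
  unfolding sentence_defs
  by (rule enlargement_transfer[OF enl]) (intro transfer_rules M s t c; simp)

lemma sum_sentence_transfer:
  assumes "P \<in> superstructure S"
  shows "sum_sentence M s t P \<longleftrightarrow> sum_sentence (star M) (star s) (star t) (star P)"
  unfolding sentence_defs
  by (rule enlargement_transfer[OF enl]) (intro transfer_rules M s t c assms; simp)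

lemma additive_sentence_transfer:
  assumes "P \<in> superstructure S"
  shows "additive_sentence M s t c P
    \<longleftrightarrow> additive_sentence (star M) (star s) (star t) (star c) (star P)"
  unfolding sentence_defs
  by (rule enlargement_transfer[OF enl]) (intro transfer_rules M s t c assms; simp)

lemma shift_sentence_transfer:
  assumes "Sig \<in> superstructure S"
  shows "shift_sentence M s t c Sig
    \<longleftrightarrow> shift_sentence (star M) (star s) (star t) (star c) (star Sig)"
  unfolding sentence_defs
  by (rule enlargement_transfer[OF enl]) (intro transfer_rules M s t c assms; simp)

lemma triangulated_sentence_transfer:
  assumes "P \<in> superstructure S" "Sig \<in> superstructure S" "D \<in> superstructure S"
  shows "triangulated_sentence M s t c P Sig D
    \<longleftrightarrow> triangulated_sentence (star M) (star s) (star t) (star c) (star P) (star Sig) (star D)"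
  unfolding sentence_defs
  by (rule enlargement_transfer[OF enl]) (intro transfer_rules M s t c assms; simp)

end

theorem proposition6p1:
  fixes S W :: "'u::set_universe"
    and star :: "'u \<Rightarrow> 'u"
    and M s t c P Sig D :: 'u
  assumes "enlargement S W star"
    and "M \<in> superstructure S - elts S"
    and "set_triangulated M s t c P Sig D"
  shows "set_triangulated (star M) (star s) (star t) (star c) (star P) (star Sig) (star D)"
proof -
  note enl = assms(1)
  have M: "M \<in> superstructure S" "M \<notin> elts S"
    using assms(2) by auto
  have s: "is_map M M s" and t: "is_map M M t" and Sig: "is_map M M Sig"
    and c: "is_rel3 M c" and P: "is_rel3 M P" and D: "is_rel3 M D"
    and tri: "triangulated_category (elts M) (app s) (app t) (rel3 c) (rel3 P) (app Sig) (rel3 D)"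
    using assms(3) by (auto simp: set_triangulated_def)
  note map = map_in_superstructure[OF M] and rel = rel3_in_superstructure[OF M]
  note map' = is_map_star[OF enl M] and rel' = is_rel3_star[OF enl M]
  note transfer = enl M(1) map[OF s] map[OF t] rel[OF c]

  interpret T: triangulated_category "elts M" "app s" "app t" "rel3 c" "rel3 P" "app Sig" "rel3 D"
    by (rule tri)
  interpret C: set_additive_category_with_shift M s t c P Sig
    by unfold_locales (fact c P Sig)+

  have "category (elts (star M)) (app (star s)) (app (star t)) (rel3 (star c))"
    using category_iff[OF c] category_iff[OF rel'[OF c]] category_sentence_transfer[OF transfer]
      T.category_axioms by blast
  then interpret star: set_category "star M" "star s" "star t" "star c"
    by (intro set_category.intro rel'[OF c])

  have "category_with_sum (elts (star M)) (app (star s)) (app (star t)) (rel3 (star c)) (rel3 (star P))"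
    using C.category_with_sum_iff[OF P] star.category_with_sum_iff[OF rel'[OF P]]
      sum_sentence_transfer[OF transfer rel[OF P]] T.category_with_sum_axioms by blast
  then interpret star: set_category_with_sum "star M" "star s" "star t" "star c" "star P"
    by (intro set_category_with_sum.intro star.set_category_axioms
        set_category_with_sum_axioms.intro rel'[OF P])

  have "additive_category (elts (star M)) (app (star s)) (app (star t)) (rel3 (star c)) (rel3 (star P))"
    using C.additive_iff star.additive_iff
      additive_sentence_transfer[OF transfer rel[OF P]] T.additive_category_axioms by blast
  then interpret star: set_additive_category "star M" "star s" "star t" "star c" "star P"
    by (intro set_additive_category.intro star.set_category_with_sum_axioms
        set_additive_category_axioms.intro)

  have "additive_category_with_shift (elts (star M)) (app (star s)) (app (star t)) (rel3 (star c))
      (rel3 (star P)) (app (star Sig))"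
    using C.additive_with_shift_iff[OF Sig] star.additive_with_shift_iff[OF map'[OF Sig]]
      shift_sentence_transfer[OF transfer map[OF Sig]] T.additive_category_with_shift_axioms by blast
  then interpret star: set_additive_category_with_shift "star M" "star s" "star t" "star c" "star P" "star Sig"
    by (intro set_additive_category_with_shift.intro star.set_additive_category_axioms
        set_additive_category_with_shift_axioms.intro map'[OF Sig])

  have "triangulated_category (elts (star M)) (app (star s)) (app (star t)) (rel3 (star c))
      (rel3 (star P)) (app (star Sig)) (rel3 (star D))"
    using C.triangulated_iff[OF D] star.triangulated_iff[OF rel'[OF D]]
      triangulated_sentence_transfer[OF transfer rel[OF P] map[OF Sig] rel[OF D]] tri by blast
  moreover have "is_set (star M)"
    using is_set_star[OF enl M(1)] superstructure_set(1)[OF M] by blast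
  ultimately show ?thesis
    using map' rel' s t Sig c P D by (simp add: set_triangulated_def)
qed

end
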